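(* Let $F,\psi,\phi$ satisfy the assumptions stated in the context, let $\Phi=F+\psi$, let $x_*=\arg\min\Phi$, and let $(x_t),(v_t),(y_t),(G_t)$ be the sequences generated by the SPAG algorithm described in the context, run with parameters $L_{F/\phi}$, $\sigma_{F/\phi}$ and starting point $x_0\in\mathrm{dom}\,\psi$. Put $\kappa_{F/\phi}=L_{F/\phi}/\sigma_{F/\phi}$. Then for all $t\ge 0$, $$\bigl(\Phi(x_t)-\Phi(x_* )\bigr)+\sigma_{F/\phi}\,D_\phi(x_*,v_t)\;\le\;\frac{1}{\bar A_t}\,D_\phi(x_*,v_0),$$ where $$\bar A_t=\frac{1}{4\sigma_{F/\phi}}\left(\prod_{\tau=0}^{t-1}(1+\gamma_\tau)-\prod_{\tau=0}^{t-1}(1-\gamma_\tau)\right)^2,\qquad \gamma_t=\frac{1}{2\sqrt{\kappa_{F/\phi}G_t}}$$ (for $t=0$, where $\bar A_0=0$, the right-hand side is read as $+\infty$).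
   Context: Norms are Euclidean. For a differentiable strictly convex $\phi$, the Bregman divergence is $D_\phi(x,y)=\phi(x)-\phi(y)-\nabla\phi(y)^\top(x-y)$. Assumptions. $\psi:\mathbb{R}^d\to\mathbb{R}\cup\{+\infty\}$ is a (proper) closed convex function. $F:\mathbb{R}^d\to\mathbb{R}$ is twice differentiable, $L_F$-smooth and $\sigma_F$-strongly convex ($\sigma_F>0$). $\phi:\mathbb{R}^d\to\mathbb{R}$ is convex, twice differentiable, $L_\phi$-smooth and $\sigma_\phi$-strongly convex ($\sigma_\phi>0$). $F$ is $L_{F/\phi}$-smooth and $\sigma_{F/\phi}$-strongly convex relative to $\phi$: $\sigma_{F/\phi}\nabla^2\phi(x)\preceq\nabla^2F(x)\preceq L_{F/\phi}\nabla^2\phi(x)$ for all $x\in\mathbb{R}^d$, with $\sigma_{F/\phi}>0$. SPAG algorithm. Initialize $v_0=x_0$, $A_0=0$, $B_0=1$, $G_{-1}=1$. For $t=0,1,2,\dots$: set $G_t=\max\{1,G_{t-1}/2\}/2$, then repeat the following steps until the inequality ( * ) below is satisfied: 1. replace $G_t$ by $2G_t$; 2. find $a_{t+1}>0$ such that $a_{t+1}^2L_{F/\phi}G_t=A_{t+1}B_{t+1}$, where $A_{t+1}=A_t+a_{t+1}$ and $B_{t+1}=B_t+a_{t+1}\sigma_{F/\phi}$; 3. set $\alpha_t=\frac{a_{t+1}}{A_{t+1}}$, $\beta_t=\frac{a_{t+1}}{B_{t+1}}\sigma_{F/\phi}$, $\eta_t=\frac{a_{t+1}}{B_{t+1}}$;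 4. set $y_t=\frac{1}{1-\alpha_t\beta_t}\bigl((1-\alpha_t)x_t+\alpha_t(1-\beta_t)v_t\bigr)$; 5. set $v_{t+1}=\arg\min_x V_t(x)$, where $V_t(x)=\eta_t\bigl(\nabla F(y_t)^\top x+\psi(x)\bigr)+(1-\beta_t)D_\phi(x,v_t)+\beta_tD_\phi(x,y_t)$; 6. set $x_{t+1}=(1-\alpha_t)x_t+\alpha_tv_{t+1}$. The stopping inequality is $$( * )\qquad D_\phi(x_{t+1},y_t)\le\alpha_t^2G_t\bigl((1-\beta_t)D_\phi(v_{t+1},v_t)+\beta_tD_\phi(v_{t+1},y_t)\bigr).$$ All quantities with index $t$ (or $t+1$) retained by the algorithm are those of the final pass of the repeat loop. *)

theory Defs
  imports "HOL-Analysis.Analysis"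
begin

section \<open>Gradients, Hessians and Bregman divergences\<close>

definition grad :: "('a::euclidean_space \<Rightarrow> real) \<Rightarrow> 'a \<Rightarrow> 'a" where
  "grad f x = (THE g. GDERIV f x :> g)"

text \<open>The Hessian is kept as a linear operator, namely the Frechet derivative of the gradient map.\<close>

definition hess :: "('a::euclidean_space \<Rightarrow> real) \<Rightarrow> 'a \<Rightarrow> 'a \<Rightarrow> 'a" where
  "hess f x = frechet_derivative (grad f) (at x)"

definition twice_differentiable :: "('a::euclidean_space \<Rightarrow> real) \<Rightarrow> bool" where
  "twice_differentiable f \<longleftrightarrow>
     (\<forall>x. f differentiable (at x)) \<and> (\<forall>x. grad f differentiable (at x))"

definition bregman :: "('a::euclidean_space \<Rightarrow> real) \<Rightarrow> 'a \<Rightarrow> 'a \<Rightarrow> real" where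
  "bregman \<phi> x y = \<phi> x - \<phi> y - grad \<phi> y \<bullet> (x - y)"

definition loewner_le :: "('a::euclidean_space \<Rightarrow> 'a) \<Rightarrow> ('a \<Rightarrow> 'a) \<Rightarrow> bool" where
  "loewner_le S T \<longleftrightarrow> (\<forall>h. h \<bullet> S h \<le> h \<bullet> T h)"


section \<open>Smoothness and convexity assumptions\<close>

definition smooth :: "real \<Rightarrow> ('a::euclidean_space \<Rightarrow> real) \<Rightarrow> bool" where
  "smooth L f \<longleftrightarrow> (\<forall>x. f differentiable (at x)) \<and> L-lipschitz_on UNIV (grad f)"

definition strongly_convex :: "real \<Rightarrow> ('a::euclidean_space \<Rightarrow> real) \<Rightarrow> bool" where
  "strongly_convex \<sigma> f \<longleftrightarrow>
     (\<forall>x y. \<forall>u\<in>{0..1}.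
        f (u *\<^sub>R x + (1 - u) *\<^sub>R y)
          \<le> u * f x + (1 - u) * f y - \<sigma> / 2 * u * (1 - u) * (norm (x - y))\<^sup>2)"

definition relatively_smooth_strongly_convex ::
    "real \<Rightarrow> real \<Rightarrow> ('a::euclidean_space \<Rightarrow> real) \<Rightarrow> ('a \<Rightarrow> real) \<Rightarrow> bool" where
  "relatively_smooth_strongly_convex L \<sigma> F \<phi> \<longleftrightarrow>
     (\<forall>x. loewner_le (\<lambda>h. \<sigma> *\<^sub>R hess \<phi> x h) (hess F x) \<and>
          loewner_le (hess F x) (\<lambda>h. L *\<^sub>R hess \<phi> x h))"

definition ereal_epigraph :: "('a \<Rightarrow> ereal) \<Rightarrow> ('a \<times> real) set" where
  "ereal_epigraph \<psi> = {(x, r). \<psi> x \<le> ereal r}"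

definition effective_domain :: "('a \<Rightarrow> ereal) \<Rightarrow> 'a set" where
  "effective_domain \<psi> = {x. \<psi> x < \<infinity>}"

definition proper_closed_convex :: "('a::euclidean_space \<Rightarrow> ereal) \<Rightarrow> bool" where
  "proper_closed_convex \<psi> \<longleftrightarrow>
     (\<forall>x. \<psi> x \<noteq> -\<infinity>) \<and> effective_domain \<psi> \<noteq> {} \<and>
     convex (ereal_epigraph \<psi>) \<and> closed (ereal_epigraph \<psi>)"


section \<open>The SPAG algorithm\<close>

text \<open>
  The parameters \<open>L\<close> and \<open>\<sigma>\<close> are the relative smoothness and relative strong
  convexity constants. In an iteration, \<open>x, v, A, B\<close> carry index \<open>t\<close>, \<open>a, v', x'\<close>
  carry index \<open>t + 1\<close>, and \<open>G\<close> is the current trial value.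
\<close>

definition spag_alpha :: "real \<Rightarrow> real \<Rightarrow> real" where
  "spag_alpha A a = a / (A + a)"

definition spag_beta :: "real \<Rightarrow> real \<Rightarrow> real \<Rightarrow> real" where
  "spag_beta \<sigma> B a = a / (B + a * \<sigma>) * \<sigma>"

definition spag_eta :: "real \<Rightarrow> real \<Rightarrow> real \<Rightarrow> real" where
  "spag_eta \<sigma> B a = a / (B + a * \<sigma>)"

definition spag_V ::
    "('a::euclidean_space \<Rightarrow> real) \<Rightarrow> ('a \<Rightarrow> ereal) \<Rightarrow> ('a \<Rightarrow> real) \<Rightarrow>
     real \<Rightarrow> real \<Rightarrow> 'a \<Rightarrow> 'a \<Rightarrow> 'a \<Rightarrow> ereal" where
  "spag_V F \<psi> \<phi> \<eta> \<beta> v y z =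
     ereal \<eta> * (ereal (grad F y \<bullet> z) + \<psi> z)
     + ereal ((1 - \<beta>) * bregman \<phi> z v + \<beta> * bregman \<phi> z y)"

definition spag_pass ::
    "real \<Rightarrow> real \<Rightarrow> ('a::euclidean_space \<Rightarrow> real) \<Rightarrow> ('a \<Rightarrow> ereal) \<Rightarrow> ('a \<Rightarrow> real) \<Rightarrow>
     'a \<Rightarrow> 'a \<Rightarrow> real \<Rightarrow> real \<Rightarrow> real \<Rightarrow> real \<Rightarrow> 'a \<Rightarrow> 'a \<Rightarrow> 'a \<Rightarrow> bool" where
  "spag_pass L \<sigma> F \<psi> \<phi> x v A B G a y v' x' \<longleftrightarrow>
     (let \<alpha> = spag_alpha A a; \<beta> = spag_beta \<sigma> B a; \<eta> = spag_eta \<sigma> B a in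
        a > 0 \<and>
        a\<^sup>2 * L * G = (A + a) * (B + a * \<sigma>) \<and>
        y = (1 / (1 - \<alpha> * \<beta>)) *\<^sub>R ((1 - \<alpha>) *\<^sub>R x + (\<alpha> * (1 - \<beta>)) *\<^sub>R v) \<and>
        is_arg_min (spag_V F \<psi> \<phi> \<eta> \<beta> v y) (\<lambda>_. True) v' \<and>
        x' = (1 - \<alpha>) *\<^sub>R x + \<alpha> *\<^sub>R v')"

definition spag_stop ::
    "real \<Rightarrow> ('a::euclidean_space \<Rightarrow> real) \<Rightarrow>
     'a \<Rightarrow> real \<Rightarrow> real \<Rightarrow> real \<Rightarrow> real \<Rightarrow> 'a \<Rightarrow> 'a \<Rightarrow> 'a \<Rightarrow> bool" where
  "spag_stop \<sigma> \<phi> v A B G a y v' x' \<longleftrightarrow>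
     (let \<alpha> = spag_alpha A a; \<beta> = spag_beta \<sigma> B a in
        bregman \<phi> x' y
          \<le> \<alpha>\<^sup>2 * G * ((1 - \<beta>) * bregman \<phi> v' v + \<beta> * bregman \<phi> v' y))"

text \<open>
  \<open>spag_repeat L \<sigma> F \<psi> \<phi> x v A B g G a y v' x'\<close>: the repeat loop, entered
  with the value \<open>g\<close> for \<open>G\<^sub>t\<close> (before the first doubling), terminates and retains
  \<open>G, a, y, v', x'\<close> from its final pass. Every earlier pass must have been carried out.
  The equation for \<open>a\<close> has no positive solution when \<open>L * G \<le> \<sigma>\<close>, so for \<open>L = \<sigma>\<close>
  the loop gets stuck at the trial value 1, and there is no run.
\<close>

inductive spag_repeat ::
    "real \<Rightarrow> real \<Rightarrow> ('a::euclidean_space \<Rightarrow> real) \<Rightarrow> ('a \<Rightarrow> ereal) \<Rightarrow> ('a \<Rightarrow> real) \<Rightarrow>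
     'a \<Rightarrow> 'a \<Rightarrow> real \<Rightarrow> real \<Rightarrow> real \<Rightarrow> real \<Rightarrow> real \<Rightarrow> 'a \<Rightarrow> 'a \<Rightarrow> 'a \<Rightarrow> bool"
  for L \<sigma> F \<psi> \<phi> x v A B
where
  finish:
    "spag_repeat L \<sigma> F \<psi> \<phi> x v A B g (2 * g) a y v' x'"
    if "spag_pass L \<sigma> F \<psi> \<phi> x v A B (2 * g) a y v' x'"
       "spag_stop \<sigma> \<phi> v A B (2 * g) a y v' x'"
| again:
    "spag_repeat L \<sigma> F \<psi> \<phi> x v A B g G a y v' x'"
    if "spag_pass L \<sigma> F \<psi> \<phi> x v A B (2 * g) a0 y0 v0 x0"
       "\<not> spag_stop \<sigma> \<phi> v A B (2 * g) a0 y0 v0 x0"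
       "spag_repeat L \<sigma> F \<psi> \<phi> x v A B (2 * g) G a y v' x'"

text \<open>\<open>spag_G_prev G t\<close> is \<open>G\<^bsub>t-1\<^esub>\<close>, with \<open>G\<^bsub>-1\<^esub> = 1\<close>.\<close>

definition spag_G_prev :: "(nat \<Rightarrow> real) \<Rightarrow> nat \<Rightarrow> real" where
  "spag_G_prev G t = (case t of 0 \<Rightarrow> 1 | Suc s \<Rightarrow> G s)"

text \<open>The value \<open>a 0\<close> is unused.\<close>

definition spag_run ::
    "real \<Rightarrow> real \<Rightarrow> ('a::euclidean_space \<Rightarrow> real) \<Rightarrow> ('a \<Rightarrow> ereal) \<Rightarrow> ('a \<Rightarrow> real) \<Rightarrow> 'a \<Rightarrow>
     (nat \<Rightarrow> 'a) \<Rightarrow> (nat \<Rightarrow> 'a) \<Rightarrow> (nat \<Rightarrow> 'a) \<Rightarrow>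
     (nat \<Rightarrow> real) \<Rightarrow> (nat \<Rightarrow> real) \<Rightarrow> (nat \<Rightarrow> real) \<Rightarrow> (nat \<Rightarrow> real) \<Rightarrow> bool" where
  "spag_run L \<sigma> F \<psi> \<phi> x0 x v y a A B G \<longleftrightarrow>
     x 0 = x0 \<and> v 0 = x0 \<and> A 0 = 0 \<and> B 0 = 1 \<and>
     (\<forall>t. spag_repeat L \<sigma> F \<psi> \<phi> (x t) (v t) (A t) (B t)
             (max 1 (spag_G_prev G t / 2) / 2)
             (G t) (a (Suc t)) (y t) (v (Suc t)) (x (Suc t)) \<and>
          A (Suc t) = A t + a (Suc t) \<and>
          B (Suc t) = B t + a (Suc t) * \<sigma>)"


section \<open>The rate\<close>

definition spag_gamma :: "real \<Rightarrow> (nat \<Rightarrow> real) \<Rightarrow> nat \<Rightarrow> real" where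
  "spag_gamma \<kappa> G t = 1 / (2 * sqrt (\<kappa> * G t))"

definition spag_Abar :: "real \<Rightarrow> (nat \<Rightarrow> real) \<Rightarrow> nat \<Rightarrow> real" where
  "spag_Abar \<sigma> \<gamma> t =
     1 / (4 * \<sigma>) * ((\<Prod>\<tau><t. 1 + \<gamma> \<tau>) - (\<Prod>\<tau><t. 1 - \<gamma> \<tau>))\<^sup>2"

end

(*
  The quantity A_t (Phi(x_t) - Phi(xstar)) + B_t D(xstar, v_t) does not increase along the run. To see
  this, bound F(x_{t+1}) from above by relative smoothness at y_t, absorb D(x_{t+1}, y_t) by the
  stopping inequality, and use the three-point inequality for the minimiser v_{t+1} of V_t at
  z = xstar; relative strong convexity pays for the term in D(xstar, y_t). The step-size equation
  is what makes the coefficients match. As B_t = 1 + sigma A_t, the rate is 1 / A_t. Finally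
  p_t = sqrt (sigma A_t) and q_t = sqrt B_t satisfy p_{t+1} >= p_t + gamma_t q_t and
  q_{t+1} >= q_t + gamma_t p_t, and the extremal solution of this system is explicit in
  p + q and q - p.
*)
theory Submission
  imports Defs
begin

section \<open>Gradients and Bregman divergences\<close>

text \<open>As \<open>grad\<close> is a definite description, both existence and uniqueness are due:
  the vector of values of \<open>f'\<close> on \<open>Basis\<close> represents \<open>f'\<close> by
  an inner product, and Frechet derivatives are unique.\<close>

lemma GDERIV_grad:
  fixes f :: "'a::euclidean_space \<Rightarrow> real"
  assumes "f differentiable (at x)"
  shows "GDERIV f x :> grad f x"
proof -
  obtain f' where f': "(f has_derivative f') (at x)"
    using assms by (auto simp: differentiable_def)
  interpret linear f' using f' by (rule has_derivative_linear)
  have "f' h = h \<bullet> (\<Sum>b\<in>Basis. f' b *\<^sub>R b)" for h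
  proof -
    have "f' h = f' (\<Sum>b\<in>Basis. (h \<bullet> b) *\<^sub>R b)" by (simp add: euclidean_representation)
    also have "\<dots> = (\<Sum>b\<in>Basis. (h \<bullet> b) * f' b)" by (simp add: sum scale)
    also have "\<dots> = h \<bullet> (\<Sum>b\<in>Basis. f' b *\<^sub>R b)" by (simp add: inner_sum_right mult.commute)
    finally show ?thesis .
  qed
  then have "f' = (\<lambda>h. h \<bullet> (\<Sum>b\<in>Basis. f' b *\<^sub>R b))" by blast
  with f' have "GDERIV f x :> (\<Sum>b\<in>Basis. f' b *\<^sub>R b)"
    unfolding gderiv_def by metis
  moreover have "g = g'" if "GDERIV f x :> g" "GDERIV f x :> g'" for g g'
  proof -
    have "(\<lambda>h. h \<bullet> g) = (\<lambda>h. h \<bullet> g')"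
      using that unfolding gderiv_def by (rule has_derivative_unique)
    then show ?thesis by (simp add: fun_eq_iff vector_eq_ldot)
  qed
  ultimately show ?thesis unfolding grad_def by (blast intro: theI)
qed

text \<open>Convexity controls increments only on the segment towards a second point, that is for
  \<open>0 < u < 1\<close>. This suffices, since the right-hand difference quotient already tends to
  \<open>f' d\<close>.\<close>

lemma has_derivative_ge_of_increment:
  fixes f :: "'a::real_normed_vector \<Rightarrow> real"
  assumes f: "(f has_derivative f') (at y)"
    and le: "\<And>u. 0 < u \<Longrightarrow> u < 1 \<Longrightarrow> u * c \<le> f (y + u *\<^sub>R d) - f y"
  shows "c \<le> f' d"
proof -
  have "((\<lambda>u. f (y + u *\<^sub>R d)) has_derivative (\<lambda>u. f' (u *\<^sub>R d))) (at 0)"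
    by (rule has_derivative_compose[where f = "\<lambda>u. y + u *\<^sub>R d"])
      (auto intro!: derivative_eq_intros f)
  then have "((\<lambda>u. f (y + u *\<^sub>R d)) has_real_derivative f' d) (at 0)"
    using has_derivative_linear[OF f]
    by (simp add: has_field_derivative_def linear_cmul mult_commute_abs)
  then have "((\<lambda>u. (f (y + u *\<^sub>R d) - f y) / u) \<longlongrightarrow> f' d) (at_right 0)"
    by (auto simp: has_field_derivative_iff intro: filterlim_at_split[THEN iffD1, THEN conjunct2])
  moreover have "\<forall>\<^sub>F u in at_right 0. c \<le> (f (y + u *\<^sub>R d) - f y) / u"
    using eventually_at_right_real[OF zero_less_one]
    by eventually_elim (use le in \<open>auto simp: field_simps\<close>)
  ultimately show ?thesis
    by (intro tendsto_lowerbound) auto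
qed

lemma bregman_nonneg:
  assumes "convex_on UNIV f" "f differentiable (at y)"
  shows "0 \<le> bregman f x y"
proof -
  \<comment> \<open>Convexity bounds increments of \<open>f\<close> from above, so the preceding
    lemma is applied to \<open>- f\<close>.\<close>
  have "((\<lambda>x. - f x) has_derivative (\<lambda>h. - (h \<bullet> grad f y))) (at y)"
    using GDERIV_grad[OF assms(2)] unfolding gderiv_def by (rule has_derivative_minus)
  then have "f y - f x \<le> - ((x - y) \<bullet> grad f y)"
  proof (rule has_derivative_ge_of_increment)
    fix u :: real assume u: "0 < u" "u < 1"
    have "f (y + u *\<^sub>R (x - y)) = f ((1 - u) *\<^sub>R y + u *\<^sub>R x)" by (simp add: algebra_simps)
    also have "\<dots> \<le> (1 - u) * f y + u * f x"
      using u by (intro convex_onD[OF assms(1)]) auto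
    finally show "u * (f y - f x) \<le> - f (y + u *\<^sub>R (x - y)) - - f y"
      by (simp add: algebra_simps)
  qed
  then show ?thesis by (simp add: bregman_def inner_commute)
qed

text \<open>On the segment from \<open>y\<close> to \<open>x\<close> the function
  \<open>k * f - c * g\<close> has nonnegative second derivative, hence stays above its tangent at
  \<open>y\<close>. Two monotonicity arguments take the place of an integral remainder, so no
  continuity of the Hessians enters. The pairs \<open>(c, k) = (1, L)\<close> and
  \<open>(\<sigma>, 1)\<close> give the two relative bounds on \<open>F\<close>.\<close>

lemma bregman_le_bregman_of_hess:
  fixes f g :: "'a::euclidean_space \<Rightarrow> real"
  assumes "twice_differentiable f" "twice_differentiable g"
    and hess: "\<And>z h. c * (h \<bullet> hess g z h) \<le> k * (h \<bullet> hess f z h)"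
  shows "c * bregman g x y \<le> k * bregman f x y"
proof -
  define d where "d = x - y"
  define r where "r t = y + t *\<^sub>R d" for t :: real
  have r: "(r has_derivative (\<lambda>s. s *\<^sub>R d)) (at t)" for t
    unfolding r_def by (auto intro!: derivative_eq_intros)
  have D1: "((\<lambda>t. p (r t)) has_real_derivative (grad p (r t) \<bullet> d)) (at t)"
    and D2: "((\<lambda>t. grad p (r t) \<bullet> d) has_real_derivative (d \<bullet> hess p (r t) d)) (at t)"
    if p: "twice_differentiable p" for p and t
  proof -
    have "(p has_derivative (\<lambda>h. h \<bullet> grad p (r t))) (at (r t))"
      using GDERIV_grad p unfolding twice_differentiable_def gderiv_def by blast
    from has_derivative_compose[OF r this]
    show "((\<lambda>t. p (r t)) has_real_derivative (grad p (r t) \<bullet> d)) (at t)"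
      by (simp add: has_field_derivative_def mult_commute_abs inner_commute)
    have "(grad p has_derivative hess p (r t)) (at (r t))"
      using p unfolding twice_differentiable_def hess_def by (simp add: frechet_derivative_works)
    from has_derivative_compose[OF r this] have *:
      "((\<lambda>t. grad p (r t) \<bullet> d) has_derivative (\<lambda>s. hess p (r t) (s *\<^sub>R d) \<bullet> d)) (at t)"
      by (rule has_derivative_inner_left)
    have "linear (hess p (r t))"
      using \<open>(grad p has_derivative hess p (r t)) (at (r t))\<close> by (rule has_derivative_linear)
    with * show "((\<lambda>t. grad p (r t) \<bullet> d) has_real_derivative (d \<bullet> hess p (r t) d)) (at t)"
      by (simp add: has_field_derivative_def linear_cmul mult_commute_abs inner_commute)
  qed
  define m where "m t = k * (grad f (r t) \<bullet> d) - c * (grad g (r t) \<bullet> d)" for t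
  have m: "m 0 \<le> m t" if "0 \<le> t" for t
  proof (rule DERIV_nonneg_imp_nondecreasing[OF that])
    fix s :: real
    have "(m has_real_derivative k * (d \<bullet> hess f (r s) d) - c * (d \<bullet> hess g (r s) d)) (at s)"
      unfolding m_def
      by (intro DERIV_diff DERIV_cmult D2 assms)
    with hess[of d "r s"]
    show "\<exists>z. (m has_real_derivative z) (at s) \<and> 0 \<le> z" by auto
  qed
  \<comment> \<open>The slope at 0 is subtracted, so that \<open>n' = m - m 0\<close> and
    \<open>n 1 - n 0\<close> is exactly the difference of the two scaled Bregman
    divergences.\<close>
  define n where "n t = k * f (r t) - c * g (r t) - t * m 0" for t
  have "n 0 \<le> n 1"
  proof (rule DERIV_nonneg_imp_nondecreasing[where f = n])
    fix s :: real assume s: "0 \<le> s"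
    have "(n has_real_derivative m s - m 0) (at s)"
      unfolding n_def m_def[of s]
      by (auto intro!: derivative_eq_intros D1 assms)
    with m[OF s] show "\<exists>z. (n has_real_derivative z) (at s) \<and> 0 \<le> z" by auto
  qed simp
  then show ?thesis
    by (simp add: n_def m_def r_def d_def bregman_def algebra_simps)
qed

section \<open>The nonsmooth term and the three-point inequality\<close>

text \<open>Transfers \<psi> to real arithmetic on its domain: the points
  \<open>(z, \<psi> z)\<close> with finite value lie in the epigraph, which is closed under convex
  combinations.\<close>

lemma proper_closed_convex_real:
  assumes "proper_closed_convex \<psi>"
  shows "convex_on (effective_domain \<psi>) (\<lambda>z. real_of_ereal (\<psi> z))"
    and "z \<in> effective_domain \<psi> \<Longrightarrow> \<psi> z = ereal (real_of_ereal (\<psi> z))"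
proof -
  have real: "\<psi> z = ereal (real_of_ereal (\<psi> z))" if "z \<in> effective_domain \<psi>" for z
    using assms that by (cases "\<psi> z") (auto simp: proper_closed_convex_def effective_domain_def)
  then show "z \<in> effective_domain \<psi> \<Longrightarrow> \<psi> z = ereal (real_of_ereal (\<psi> z))" .
  \<comment> \<open>The right side is finite, so this one bound gives convexity of the domain as
    well as of the function.\<close>
  have comb: "\<psi> (u *\<^sub>R z + w *\<^sub>R z') \<le> ereal (u * real_of_ereal (\<psi> z) + w * real_of_ereal (\<psi> z'))"
    if "z \<in> effective_domain \<psi>" "z' \<in> effective_domain \<psi>" "0 \<le> u" "0 \<le> w" "u + w = 1" for u w z z'
  proof -
    have "(z, real_of_ereal (\<psi> z)) \<in> ereal_epigraph \<psi>" "(z', real_of_ereal (\<psi> z')) \<in> ereal_epigraph \<psi>"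
      using real that by (auto simp: ereal_epigraph_def)
    with that assms
    have "u *\<^sub>R (z, real_of_ereal (\<psi> z)) + w *\<^sub>R (z', real_of_ereal (\<psi> z')) \<in> ereal_epigraph \<psi>"
      by (intro convexD) (auto simp: proper_closed_convex_def)
    then show ?thesis by (simp add: ereal_epigraph_def)
  qed
  have dom: "convex (effective_domain \<psi>)"
  proof (rule convexI)
    fix z z' :: 'a and u w :: real
    assume "z \<in> effective_domain \<psi>" "z' \<in> effective_domain \<psi>" "0 \<le> u" "0 \<le> w" "u + w = 1"
    from comb[OF this] show "u *\<^sub>R z + w *\<^sub>R z' \<in> effective_domain \<psi>"
      by (auto simp: effective_domain_def)
  qed
  show "convex_on (effective_domain \<psi>) (\<lambda>z. real_of_ereal (\<psi> z))"
    unfolding convex_on_def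
  proof (intro conjI dom ballI allI impI)
    fix z z' u w assume *: "z \<in> effective_domain \<psi>" "z' \<in> effective_domain \<psi>"
      "0 \<le> u" "0 \<le> w" "u + w = (1::real)"
    from convexD[OF dom *] real comb[OF *]
    show "real_of_ereal (\<psi> (u *\<^sub>R z + w *\<^sub>R z')) \<le> u * real_of_ereal (\<psi> z) + w * real_of_ereal (\<psi> z')"
      by (metis ereal_less_eq(3))
  qed
qed

text \<open>First-order optimality of \<open>w\<close> for \<open>g + \<phi>\<close>: a small move
  towards \<open>z\<close> cannot lower the sum. Here \<open>g\<close> enters through its chord and
  only \<phi> is differentiated, so no subgradient of \<open>g\<close> is involved.\<close>

lemma bregman_prox_inequality:
  fixes \<phi> :: "'a::euclidean_space \<Rightarrow> real"
  assumes g: "convex_on S g" and diff: "\<phi> differentiable (at w)"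
    and w: "w \<in> S" and min: "\<And>z. z \<in> S \<Longrightarrow> g w + \<phi> w \<le> g z + \<phi> z"
    and z: "z \<in> S"
  shows "g w + \<phi> w + bregman \<phi> z w \<le> g z + \<phi> z"
proof -
  have "g w - g z \<le> (z - w) \<bullet> grad \<phi> w"
  proof (rule has_derivative_ge_of_increment[OF GDERIV_grad[OF diff, unfolded gderiv_def]])
    fix u :: real assume u: "0 < u" "u < 1"
    have eq: "w + u *\<^sub>R (z - w) = (1 - u) *\<^sub>R w + u *\<^sub>R z" by (simp add: algebra_simps)
    have "w + u *\<^sub>R (z - w) \<in> S"
      unfolding eq using u by (intro convexD convex_on_imp_convex[OF g] w z) auto
    moreover have "g (w + u *\<^sub>R (z - w)) \<le> (1 - u) * g w + u * g z"
      unfolding eq using u by (intro convex_onD[OF g] w z) auto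
    ultimately show "u * (g w - g z) \<le> \<phi> (w + u *\<^sub>R (z - w)) - \<phi> w"
      using min[of "w + u *\<^sub>R (z - w)"] by (simp add: algebra_simps)
  qed
  then show ?thesis by (simp add: bregman_def inner_commute)
qed

section \<open>One iteration of SPAG\<close>

text \<open>The analysis sees the final pass only; the rejected passes merely double the trial
  value, which keeps it positive.\<close>

lemma spag_repeat_final_pass:
  assumes "spag_repeat L \<sigma> F \<psi> \<phi> x v A B g G a y v' x'" "0 < g"
  shows "0 < G" "spag_pass L \<sigma> F \<psi> \<phi> x v A B G a y v' x'" "spag_stop \<sigma> \<phi> v A B G a y v' x'"
proof -
  have "0 < G \<and> spag_pass L \<sigma> F \<psi> \<phi> x v A B G a y v' x' \<and> spag_stop \<sigma> \<phi> v A B G a y v' x'"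
    using assms by (induction) auto
  then show "0 < G" "spag_pass L \<sigma> F \<psi> \<phi> x v A B G a y v' x'"
    "spag_stop \<sigma> \<phi> v A B G a y v' x'" by blast+
qed

text \<open>The weights \<open>1 - \<beta>\<close> and \<beta> sum to 1, so the objective is
  \<open>\<eta> * \<psi> + \<phi>\<close> up to an affine function. The three-point inequality then
  applies with the affine part counted to the convex summand. The divergences to \<open>v\<close>
  and \<open>y\<close> differ from \<phi> by affine terms only.\<close>

lemma spag_V_argmin_inequality:
  fixes \<phi> :: "'a::euclidean_space \<Rightarrow> real"
  assumes psi: "proper_closed_convex \<psi>" and diff: "\<phi> differentiable (at w)" and eta: "0 < \<eta>"
    and min: "is_arg_min (spag_V F \<psi> \<phi> \<eta> \<beta> v y) (\<lambda>_. True) w"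
    and z: "z \<in> effective_domain \<psi>"
  shows "w \<in> effective_domain \<psi>"
    and "\<eta> * (grad F y \<bullet> w + real_of_ereal (\<psi> w))
           + (1 - \<beta>) * bregman \<phi> w v + \<beta> * bregman \<phi> w y + bregman \<phi> z w
         \<le> \<eta> * (grad F y \<bullet> z + real_of_ereal (\<psi> z))
           + (1 - \<beta>) * bregman \<phi> z v + \<beta> * bregman \<phi> z y"
proof -
  let ?p = "\<lambda>z. real_of_ereal (\<psi> z)"
  define q where "q z = \<eta> * (grad F y \<bullet> z + ?p z) + ((1 - \<beta>) * bregman \<phi> z v + \<beta> * bregman \<phi> z y)" for z
  have V: "spag_V F \<psi> \<phi> \<eta> \<beta> v y z = ereal (q z)" if "z \<in> effective_domain \<psi>" for z
    by (simp add: spag_V_def q_def proper_closed_convex_real(2)[OF psi that, symmetric])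
      (subst proper_closed_convex_real(2)[OF psi that], simp)
  have le: "spag_V F \<psi> \<phi> \<eta> \<beta> v y w \<le> spag_V F \<psi> \<phi> \<eta> \<beta> v y z" for z
    using min by (auto simp: is_arg_min_linorder)
  show w: "w \<in> effective_domain \<psi>"
  proof (rule ccontr)
    assume "w \<notin> effective_domain \<psi>"
    then have "\<psi> w = \<infinity>" by (auto simp: effective_domain_def)
    with eta have "spag_V F \<psi> \<phi> \<eta> \<beta> v y w = \<infinity>" by (simp add: spag_V_def)
    with le[of z] V[OF z] show False by simp
  qed
  have qle: "q w \<le> q z" if "z \<in> effective_domain \<psi>" for z
    using le[of z] V[OF that] V[OF w] by simp
  \<comment> \<open>Slope and constant of the affine part that remains once one copy of \<phi> and
    \<open>\<eta> * \<psi>\<close> are split off.\<close>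
  define b where "b = - (1 - \<beta>) *\<^sub>R grad \<phi> v - \<beta> *\<^sub>R grad \<phi> y + \<eta> *\<^sub>R grad F y"
  define c where "c = (1 - \<beta>) * (grad \<phi> v \<bullet> v - \<phi> v) + \<beta> * (grad \<phi> y \<bullet> y - \<phi> y)"
  have q: "q z = (\<eta> * ?p z + (b \<bullet> z + c)) + \<phi> z" for z
    by (simp add: q_def b_def c_def bregman_def inner_diff_left inner_diff_right inner_add_left algebra_simps)
  have "convex_on (effective_domain \<psi>) (\<lambda>z. \<eta> * ?p z + (b \<bullet> z + c))"
  proof (rule convex_on_add)
    show "convex_on (effective_domain \<psi>) (\<lambda>z. \<eta> * ?p z)"
      using eta proper_closed_convex_real(1)[OF psi] by (intro convex_on_cmul) auto
    show "convex_on (effective_domain \<psi>) (\<lambda>z. b \<bullet> z + c)"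
      unfolding convex_on_def
    proof (intro conjI convex_on_imp_convex[OF proper_closed_convex_real(1)[OF psi]] ballI allI impI)
      fix z z' :: 'a and u s :: real assume "u + s = 1"
      then have "c = u * c + s * c" by (metis distrib_right mult_1)
      then show "b \<bullet> (u *\<^sub>R z + s *\<^sub>R z') + c \<le> u * (b \<bullet> z + c) + s * (b \<bullet> z' + c)"
        by (simp add: inner_add_right algebra_simps)
    qed
  qed
  from bregman_prox_inequality[OF this diff w _ z] qle
  have "q w + bregman \<phi> z w \<le> q z" by (simp add: q)
  then show "\<eta> * (grad F y \<bullet> w + ?p w) + (1 - \<beta>) * bregman \<phi> w v + \<beta> * bregman \<phi> w y + bregman \<phi> z w
         \<le> \<eta> * (grad F y \<bullet> z + ?p z) + (1 - \<beta>) * bregman \<phi> z v + \<beta> * bregman \<phi> z y"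
    by (simp add: q_def)
qed

lemma spag_step_descent:
  fixes F \<phi> :: "'a::euclidean_space \<Rightarrow> real"
  assumes psi: "proper_closed_convex \<psi>" and diff: "\<phi> differentiable (at v')"
    and F_upper: "\<And>x y. bregman F x y \<le> L * bregman \<phi> x y"
    and F_lower: "\<And>x y. \<sigma> * bregman \<phi> x y \<le> bregman F x y"
    and phi: "\<And>x y. 0 \<le> bregman \<phi> x y"
    and pos: "0 < \<sigma>" "0 \<le> A" "0 < B" "0 < G"
    and pass: "spag_pass L \<sigma> F \<psi> \<phi> x v A B G a y v' x'"
    and stop: "spag_stop \<sigma> \<phi> v A B G a y v' x'"
    and x: "x \<in> effective_domain \<psi>" and z: "z \<in> effective_domain \<psi>"
  defines "P \<equiv> \<lambda>z. F z + real_of_ereal (\<psi> z)"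
  shows "x' \<in> effective_domain \<psi>"
    and "(A + a) * (P x' - P z) + (B + a * \<sigma>) * bregman \<phi> z v'
         \<le> A * (P x - P z) + B * bregman \<phi> z v"
proof -
  let ?p = "\<lambda>z. real_of_ereal (\<psi> z)"
  define \<alpha> where "\<alpha> = spag_alpha A a"
  define \<beta> where "\<beta> = spag_beta \<sigma> B a"
  define \<eta> where "\<eta> = spag_eta \<sigma> B a"
  have a: "0 < a" and step: "a\<^sup>2 * L * G = (A + a) * (B + a * \<sigma>)"
    and min: "is_arg_min (spag_V F \<psi> \<phi> \<eta> \<beta> v y) (\<lambda>_. True) v'"
    and x': "x' = (1 - \<alpha>) *\<^sub>R x + \<alpha> *\<^sub>R v'"
    using pass by (auto simp: spag_pass_def Let_def \<alpha>_def \<beta>_def \<eta>_def)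
  have A': "0 < A + a" and B': "0 < B + a * \<sigma>"
    using a pos by (auto intro: add_nonneg_pos add_pos_pos)
  \<comment> \<open>The step-size equation has a positive right side, which forces the sign of
    \<open>L\<close>.\<close>
  have L: "0 < L"
  proof -
    have "0 < (a\<^sup>2 * G) * L" using step A' B' by (simp add: mult.commute mult.left_commute)
    then show ?thesis by (rule zero_less_mult_pos) (use a pos in simp)
  qed
  \<comment> \<open>Cleared of denominators, \<alpha> splits \<open>A + a\<close> into
    \<open>a\<close> and \<open>A\<close>, and \<beta> splits \<open>B + a * \<sigma>\<close> into
    \<open>a * \<sigma>\<close> and \<open>B\<close>. This turns averaged inequalities into weighted
    ones.\<close>
  have al: "0 \<le> \<alpha>" "\<alpha> \<le> 1" "(A + a) * \<alpha> = a" "(A + a) * (1 - \<alpha>) = A"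
    using a pos A' by (auto simp: \<alpha>_def spag_alpha_def field_simps)
  have be: "(B + a * \<sigma>) * \<beta> = a * \<sigma>" "(B + a * \<sigma>) * (1 - \<beta>) = B"
    using B' by (auto simp: \<beta>_def spag_beta_def right_diff_distrib)
  have eta: "0 < \<eta>" "(B + a * \<sigma>) * \<eta> = a"
    using a B' by (auto simp: \<eta>_def spag_eta_def)
  note prox = spag_V_argmin_inequality[OF psi diff eta(1) min z]
  note cvx = proper_closed_convex_real(1)[OF psi]
  show "x' \<in> effective_domain \<psi>"
    unfolding x' using al by (intro convexD convex_on_imp_convex[OF cvx] x prox(1)) auto
  have p: "?p x' \<le> (1 - \<alpha>) * ?p x + \<alpha> * ?p v'"
    unfolding x' using al by (intro convex_onD[OF cvx] x prox(1)) auto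

  \<comment> \<open>\<open>E\<close> is both the bracket of the stopping inequality and the Bregman
    part of the objective at \<open>v'\<close>; it will cancel between the facts \<open>1\<close>
    and \<open>2\<close>. The linearisation \<open>l\<close> of \<open>F\<close> at \<open>y\<close>
    is affine, so it splits exactly along the combination defining \<open>x'\<close>.\<close>
  define E where "E = (1 - \<beta>) * bregman \<phi> v' v + \<beta> * bregman \<phi> v' y"
  define l where "l z = F y + grad F y \<bullet> (z - y)" for z
  have "bregman \<phi> x' y \<le> \<alpha>\<^sup>2 * G * E"
    using stop by (simp add: spag_stop_def Let_def \<alpha>_def \<beta>_def E_def)
  then have "L * bregman \<phi> x' y \<le> L * (\<alpha>\<^sup>2 * G * E)" using L by (intro mult_left_mono) auto
  with F_upper[of x' y] have "F x' \<le> l x' + L * (\<alpha>\<^sup>2 * G * E)"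
    by (simp add: bregman_def[of F] l_def)
  moreover have "l x' = (1 - \<alpha>) * l x + \<alpha> * l v'"
    by (simp add: l_def x' inner_diff_right inner_add_right algebra_simps)
  moreover have "l x \<le> F x"
    using F_lower[of x y] mult_nonneg_nonneg[OF less_imp_le[OF pos(1)] phi[of x y]]
    by (simp add: bregman_def[of F] l_def)
  then have "(1 - \<alpha>) * l x \<le> (1 - \<alpha>) * F x" using al by (intro mult_left_mono) auto
  ultimately have "P x' \<le> (1 - \<alpha>) * P x + \<alpha> * (l v' + ?p v') + L * (\<alpha>\<^sup>2 * G * E)"
    using p by (simp add: P_def algebra_simps)
  then have "(A + a) * P x' \<le> (A + a) * ((1 - \<alpha>) * P x + \<alpha> * (l v' + ?p v') + L * (\<alpha>\<^sup>2 * G * E))"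
    using A' by (intro mult_left_mono) auto
  also have "\<dots> = ((A + a) * (1 - \<alpha>)) * P x + ((A + a) * \<alpha>) * (l v' + ?p v') + ((A + a) * \<alpha>\<^sup>2 * L * G) * E"
    by (simp add: algebra_simps)
  \<comment> \<open>The step-size equation gives \<open>E\<close> the same weight here as in the
    prox inequality scaled by \<open>B + a * \<sigma>\<close>.\<close>
  also have "(A + a) * \<alpha>\<^sup>2 * L * G = B + a * \<sigma>"
  proof -
    have "(A + a) * ((A + a) * \<alpha>\<^sup>2 * L * G) = ((A + a) * \<alpha>)\<^sup>2 * L * G"
      by (simp add: power2_eq_square algebra_simps)
    also have "\<dots> = (A + a) * (B + a * \<sigma>)" by (simp only: al step)
    finally show ?thesis using A' by (metis mult_left_cancel less_irrefl)
  qed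
  finally have 1: "(A + a) * P x' \<le> A * P x + a * (l v' + ?p v') + (B + a * \<sigma>) * E"
    by (simp only: al)

  \<comment> \<open>Both sides receive the constant
    \<open>\<eta> * (F y - grad F y \<bullet> y)\<close>, which turns the linear terms into
    \<open>l\<close>.\<close>
  have "\<eta> * (l v' + ?p v') + E + bregman \<phi> z v'
        \<le> \<eta> * (l z + ?p z) + (1 - \<beta>) * bregman \<phi> z v + \<beta> * bregman \<phi> z y"
    using prox(2) by (simp add: E_def l_def inner_diff_right algebra_simps)
  then have "(B + a * \<sigma>) * (\<eta> * (l v' + ?p v') + E + bregman \<phi> z v')
        \<le> (B + a * \<sigma>) * (\<eta> * (l z + ?p z) + (1 - \<beta>) * bregman \<phi> z v + \<beta> * bregman \<phi> z y)"
    using B' by (intro mult_left_mono) auto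
  then have "((B + a * \<sigma>) * \<eta>) * (l v' + ?p v') + (B + a * \<sigma>) * E + (B + a * \<sigma>) * bregman \<phi> z v'
        \<le> ((B + a * \<sigma>) * \<eta>) * (l z + ?p z) + ((B + a * \<sigma>) * (1 - \<beta>)) * bregman \<phi> z v
           + ((B + a * \<sigma>) * \<beta>) * bregman \<phi> z y"
    by (simp only: distrib_left mult.assoc)
  then have 2: "a * (l v' + ?p v') + (B + a * \<sigma>) * E + (B + a * \<sigma>) * bregman \<phi> z v'
        \<le> a * (l z + ?p z) + B * bregman \<phi> z v + a * \<sigma> * bregman \<phi> z y"
    by (simp only: be eta)
  have "l z + \<sigma> * bregman \<phi> z y \<le> F z"
    using F_lower[of z y] by (simp add: bregman_def[of F] l_def)
  then have "a * (l z + \<sigma> * bregman \<phi> z y) \<le> a * F z" using a by (intro mult_left_mono) auto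
  with 1 2 show "(A + a) * (P x' - P z) + (B + a * \<sigma>) * bregman \<phi> z v'
         \<le> A * (P x - P z) + B * bregman \<phi> z v"
    by (simp add: P_def algebra_simps)
qed

section \<open>Growth of the coefficient sequences\<close>

text \<open>Factor \<open>r - s\<close> as a difference of squares and enlarge \<open>sqrt s\<close>
  to \<open>sqrt r\<close> in the sum. The new value \<open>r\<close> stands under the root because
  the step-size equation involves the updated coefficients.\<close>

lemma sqrt_increment_ge:
  fixes s r c :: real
  assumes "0 \<le> s" "s \<le> r" "0 < r" "2 * c * sqrt r \<le> r - s"
  shows "sqrt s + c \<le> sqrt r"
proof (cases "c \<le> 0")
  case True
  then show ?thesis using real_sqrt_le_mono[OF assms(2)] by linarith
next
  case False
  have "2 * c * sqrt r \<le> (sqrt r - sqrt s) * (sqrt r + sqrt s)"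
    using assms by (simp add: algebra_simps)
  also have "\<dots> \<le> (sqrt r - sqrt s) * (2 * sqrt r)"
    using assms by (intro mult_left_mono) auto
  finally have "c * (2 * sqrt r) \<le> (sqrt r - sqrt s) * (2 * sqrt r)" by (simp add: mult_ac)
  then show ?thesis using assms(3) by simp
qed

text \<open>With equality in the recursions, \<open>p + q\<close> is multiplied by
  \<open>1 + \<gamma> t\<close> and \<open>q - p\<close> by \<open>1 - \<gamma> t\<close>; half the
  difference and half the sum of the products are that solution, and the comparison is by
  induction.\<close>

lemma coupled_growth_lower_bound:
  fixes p q \<gamma> :: "nat \<Rightarrow> real"
  assumes "p 0 = 0" "q 0 = 1" "\<And>t. 0 < \<gamma> t"
    and "\<And>t. p t + \<gamma> t * q t \<le> p (Suc t)" "\<And>t. q t + \<gamma> t * p t \<le> q (Suc t)"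
  shows "((\<Prod>\<tau><t. 1 + \<gamma> \<tau>) - (\<Prod>\<tau><t. 1 - \<gamma> \<tau>)) / 2 \<le> p t"
    and "0 < t \<Longrightarrow> 0 < (\<Prod>\<tau><t. 1 + \<gamma> \<tau>) - (\<Prod>\<tau><t. 1 - \<gamma> \<tau>)"
proof -
  let ?p = "\<lambda>t. ((\<Prod>\<tau><t. 1 + \<gamma> \<tau>) - (\<Prod>\<tau><t. 1 - \<gamma> \<tau>)) / 2"
  let ?q = "\<lambda>t. ((\<Prod>\<tau><t. 1 + \<gamma> \<tau>) + (\<Prod>\<tau><t. 1 - \<gamma> \<tau>)) / 2"
  have rec: "?p (Suc t) = ?p t + \<gamma> t * ?q t" "?q (Suc t) = ?q t + \<gamma> t * ?p t" for t
    by (simp_all add: field_simps)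
  \<comment> \<open>The factors \<open>1 - \<gamma> \<tau>\<close> may have either sign here, so the
    sign parts are carried through the recursion. They later give strict positivity for
    \<open>t > 0\<close>, hence a nonzero denominator in the rate.\<close>
  have inv: "?p t \<le> p t \<and> ?q t \<le> q t \<and> 0 \<le> ?p t \<and> 1 \<le> ?q t" for t
  proof (induction t)
    case 0
    then show ?case using assms by simp
  next
    case (Suc t)
    then have "\<gamma> t * ?q t \<le> \<gamma> t * q t" "\<gamma> t * ?p t \<le> \<gamma> t * p t"
      "0 \<le> \<gamma> t * ?q t" "0 \<le> \<gamma> t * ?p t"
      using assms(3)[of t] by (auto intro!: mult_left_mono mult_nonneg_nonneg)
    with Suc show ?case unfolding rec using assms(4,5)[of t] by linarith
  qed
  then show "?p t \<le> p t" by blast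
  show "0 < (\<Prod>\<tau><t. 1 + \<gamma> \<tau>) - (\<Prod>\<tau><t. 1 - \<gamma> \<tau>)" if "0 < t"
  proof -
    from that obtain s where s: "t = Suc s" by (cases t) auto
    have "0 \<le> ?p s" "1 \<le> ?q s" using inv by blast+
    then have "0 < ?p s + \<gamma> s * ?q s"
      using assms(3)[of s] by (intro add_nonneg_pos mult_pos_pos) auto
    then show ?thesis unfolding s rec(1)[symmetric] by simp
  qed
qed

section \<open>Convergence rate along the run\<close>

theorem theorem1:
  fixes F \<phi> :: "real ^ 'd \<Rightarrow> real"
    and \<psi> \<Phi> :: "real ^ 'd \<Rightarrow> ereal"
    and L\<^sub>F \<sigma>\<^sub>F L\<^sub>\<phi> \<sigma>\<^sub>\<phi> L \<sigma> \<kappa> :: real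
    and x0 xstar :: "real ^ 'd"
    and x v y :: "nat \<Rightarrow> real ^ 'd"
    and a A B G \<gamma> :: "nat \<Rightarrow> real"
  assumes psi: "proper_closed_convex \<psi>"
    and F: "twice_differentiable F" "smooth L\<^sub>F F" "strongly_convex \<sigma>\<^sub>F F" "\<sigma>\<^sub>F > 0"
    and phi: "convex_on UNIV \<phi>" "twice_differentiable \<phi>" "smooth L\<^sub>\<phi> \<phi>"
             "strongly_convex \<sigma>\<^sub>\<phi> \<phi>" "\<sigma>\<^sub>\<phi> > 0"
    and rel: "relatively_smooth_strongly_convex L \<sigma> F \<phi>" "\<sigma> > 0"
    and Phi: "\<Phi> = (\<lambda>z. ereal (F z) + \<psi> z)"
    and xstar: "is_arg_min \<Phi> (\<lambda>_. True) xstar"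
    and x0: "x0 \<in> effective_domain \<psi>"
    and run: "spag_run L \<sigma> F \<psi> \<phi> x0 x v y a A B G"
    and kappa: "\<kappa> = L / \<sigma>"
    and gamma: "\<gamma> = spag_gamma \<kappa> G"
  shows "\<forall>t. (\<Phi> (x t) - \<Phi> xstar) + ereal (\<sigma> * bregman \<phi> xstar (v t))
           \<le> (if t = 0 then \<infinity>
              else ereal (1 / spag_Abar \<sigma> \<gamma> t * bregman \<phi> xstar (v 0)))"
proof (intro allI)
  fix t
  let ?P = "\<lambda>z. F z + real_of_ereal (\<psi> z)"
  have init: "x 0 = x0" "v 0 = x0" "A 0 = 0" "B 0 = 1"
    and rep: "\<And>t. spag_repeat L \<sigma> F \<psi> \<phi> (x t) (v t) (A t) (B t)
             (max 1 (spag_G_prev G t / 2) / 2) (G t) (a (Suc t)) (y t) (v (Suc t)) (x (Suc t))"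
    and AS: "\<And>t. A (Suc t) = A t + a (Suc t)" and BS: "\<And>t. B (Suc t) = B t + a (Suc t) * \<sigma>"
    using run by (auto simp: spag_run_def)
  note final = spag_repeat_final_pass[OF rep, simplified]
  \<comment> \<open>The loop is entered with a value of at least 1/2.\<close>
  have G: "0 < G t" for t by (rule final(1)) (simp add: less_max_iff_disj)
  have pass: "spag_pass L \<sigma> F \<psi> \<phi> (x t) (v t) (A t) (B t) (G t) (a (Suc t)) (y t) (v (Suc t)) (x (Suc t))" for t
    by (rule final(2)) (simp add: less_max_iff_disj)
  have stop: "spag_stop \<sigma> \<phi> (v t) (A t) (B t) (G t) (a (Suc t)) (y t) (v (Suc t)) (x (Suc t))" for t
    by (rule final(3)) (simp add: less_max_iff_disj)
  have a: "0 < a (Suc t)"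
    and step: "(a (Suc t))\<^sup>2 * L * G t = A (Suc t) * B (Suc t)" for t
    using pass[of t] by (auto simp: spag_pass_def Let_def AS BS)
  have A: "0 \<le> A t" for t by (induction t) (use a in \<open>auto simp: init AS intro: add_nonneg_nonneg less_imp_le\<close>)
  have B: "B t = 1 + \<sigma> * A t" for t by (induction t) (auto simp: init AS BS algebra_simps)
  have B_pos: "0 < B t" for t using A[of t] rel(2) by (simp add: B add_pos_nonneg)

  have upper: "bregman F z w \<le> L * bregman \<phi> z w" for z w
    using bregman_le_bregman_of_hess[OF phi(2) F(1), of 1 L] rel(1)
    by (simp add: relatively_smooth_strongly_convex_def loewner_le_def)
  have lower: "\<sigma> * bregman \<phi> z w \<le> bregman F z w" for z w
    using bregman_le_bregman_of_hess[OF F(1) phi(2), of \<sigma> 1] rel(1)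
    by (simp add: relatively_smooth_strongly_convex_def loewner_le_def)
  have diff: "\<phi> differentiable (at z)" for z using phi(2) by (simp add: twice_differentiable_def)
  note nonneg = bregman_nonneg[OF phi(1) diff]

  have Phi_dom: "\<Phi> z = ereal (?P z)" if "z \<in> effective_domain \<psi>" for z
    unfolding Phi by (subst proper_closed_convex_real(2)[OF psi that]) simp
  have Phi_min: "\<Phi> xstar \<le> \<Phi> z" for z
    using xstar by (auto simp: is_arg_min_linorder)
  \<comment> \<open>A minimiser has finite value because the starting point does.\<close>
  have xs: "xstar \<in> effective_domain \<psi>"
    using Phi_min[of x0] Phi_dom[OF x0] by (cases "\<psi> xstar") (auto simp: Phi effective_domain_def)

  note descent = spag_step_descent[OF psi diff upper lower nonneg rel(2) A B_pos G pass stop _ xs]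
  have x: "x t \<in> effective_domain \<psi>" for t
    by (induction t) (auto simp: init x0 intro: descent(1))
  \<comment> \<open>The bound starts from \<open>A 0 = 0\<close> and \<open>B 0 = 1\<close>, so the
    initial function gap leaves no trace.\<close>
  have lyap: "A t * (?P (x t) - ?P xstar) + B t * bregman \<phi> xstar (v t) \<le> bregman \<phi> xstar (v 0)" for t
  proof (induction t)
    case 0
    show ?case by (simp add: init)
  next
    case (Suc t)
    with descent(2)[OF x, of t] show ?case by (simp add: AS BS)
  qed

  have L: "0 < L"
  proof -
    have "0 < A (Suc 0) * B (Suc 0)" using a[of 0] B_pos by (simp add: AS init)
    then have "0 < ((a (Suc 0))\<^sup>2 * G 0) * L" using step[of 0] by (simp add: mult.commute mult.left_commute)
    then show ?thesis by (rule zero_less_mult_pos) (use a[of 0] G[of 0] in simp)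
  qed
  have gam: "0 < \<gamma> t" for t
    using L G[of t] rel(2) by (simp add: gamma kappa spag_gamma_def)
  \<comment> \<open>The root of \<sigma> times the step-size equation, with
    \<open>\<sigma> * L = \<sigma>\<^sup>2 * \<kappa>\<close>; \<gamma> is the value for which
    \<open>2 * \<gamma> t * sqrt (\<kappa> * G t) = 1\<close>. The right side is the increment of
    \<open>\<sigma> * A\<close> and of \<open>B\<close> alike, so it serves both growth
    bounds.\<close>
  have incr: "2 * \<gamma> t * (sqrt (\<sigma> * A (Suc t)) * sqrt (B (Suc t))) = \<sigma> * a (Suc t)" for t
  proof -
    have "sqrt (\<sigma> * A (Suc t)) * sqrt (B (Suc t)) = sqrt (\<sigma> * ((a (Suc t))\<^sup>2 * L * G t))"
      by (simp add: step real_sqrt_mult)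
    also have "\<dots> = sqrt ((\<sigma> * a (Suc t))\<^sup>2 * (\<kappa> * G t))"
      using rel(2) by (simp add: kappa power2_eq_square field_simps)
    also have "\<dots> = \<sigma> * a (Suc t) * sqrt (\<kappa> * G t)"
      using rel(2) a[of t] by (simp add: real_sqrt_mult)
    finally show ?thesis
      using L G[of t] rel(2) by (simp add: gamma spag_gamma_def kappa)
  qed
  \<comment> \<open>The root estimate has the other sequence at \<open>Suc t\<close>; monotonicity
    moves it back to \<open>t\<close>.\<close>
  have mono: "0 \<le> \<gamma> t * (sqrt (B (Suc t)) - sqrt (B t))"
    "0 \<le> \<gamma> t * (sqrt (\<sigma> * A (Suc t)) - sqrt (\<sigma> * A t))" for t
    using gam[of t] a[of t] rel(2) by (auto simp: AS BS intro!: mult_nonneg_nonneg less_imp_le)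
  have grow1: "sqrt (\<sigma> * A t) + \<gamma> t * sqrt (B t) \<le> sqrt (\<sigma> * A (Suc t))" for t
  proof -
    have "sqrt (\<sigma> * A t) + \<gamma> t * sqrt (B (Suc t)) \<le> sqrt (\<sigma> * A (Suc t))"
      using incr[of t] A[of t] a[of t] rel(2)
      by (intro sqrt_increment_ge) (auto simp: AS algebra_simps intro: add_nonneg_pos)
    with mono(1)[of t] show ?thesis by (simp add: algebra_simps)
  qed
  have grow2: "sqrt (B t) + \<gamma> t * sqrt (\<sigma> * A t) \<le> sqrt (B (Suc t))" for t
  proof -
    have "sqrt (B t) + \<gamma> t * sqrt (\<sigma> * A (Suc t)) \<le> sqrt (B (Suc t))"
      using incr[of t] B_pos[of t] a[of t] rel(2)
      by (intro sqrt_increment_ge) (auto simp: BS algebra_simps intro: add_pos_pos)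
    with mono(2)[of t] show ?thesis by (simp add: algebra_simps)
  qed
  note bounds = coupled_growth_lower_bound[where p = "\<lambda>t. sqrt (\<sigma> * A t)" and q = "\<lambda>t. sqrt (B t)",
      OF _ _ gam grow1 grow2, simplified init, simplified]

  show "(\<Phi> (x t) - \<Phi> xstar) + ereal (\<sigma> * bregman \<phi> xstar (v t))
           \<le> (if t = 0 then \<infinity> else ereal (1 / spag_Abar \<sigma> \<gamma> t * bregman \<phi> xstar (v 0)))"
  proof (cases "t = 0")
    case False
    define R where "R = (\<Prod>\<tau><t. 1 + \<gamma> \<tau>) - (\<Prod>\<tau><t. 1 - \<gamma> \<tau>)"
    have R: "0 < R" "R / 2 \<le> sqrt (\<sigma> * A t)"
      using bounds False by (auto simp: R_def)
    have Abar: "spag_Abar \<sigma> \<gamma> t = R\<^sup>2 / (4 * \<sigma>)" by (simp add: spag_Abar_def R_def)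
    have Abar_pos: "0 < spag_Abar \<sigma> \<gamma> t" using R rel(2) by (simp add: Abar)
    have "(R / 2)\<^sup>2 \<le> (sqrt (\<sigma> * A t))\<^sup>2" using R by (intro power_mono) auto
    then have Abar_le: "spag_Abar \<sigma> \<gamma> t \<le> A t"
      using A[of t] rel(2) by (simp add: Abar power_divide field_simps)
    let ?gap = "?P (x t) - ?P xstar + \<sigma> * bregman \<phi> xstar (v t)"
    have "0 \<le> ?P (x t) - ?P xstar"
      using Phi_min[of "x t"] by (simp add: Phi_dom x xs)
    \<comment> \<open>Nonnegativity of the gap allows \<open>A t\<close> to be replaced by the
      smaller \<open>spag_Abar \<sigma> \<gamma> t\<close>.\<close>
    then have "0 \<le> ?gap" using rel(2) nonneg by (intro add_nonneg_nonneg mult_nonneg_nonneg) auto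
    with Abar_le have "spag_Abar \<sigma> \<gamma> t * ?gap \<le> A t * ?gap" by (rule mult_right_mono)
    \<comment> \<open>As \<open>B t = 1 + \<sigma> * A t\<close>, the Lyapunov bound exceeds
      \<open>A t * ?gap\<close> by one divergence, which is nonnegative and dropped.\<close>
    also have "\<dots> \<le> bregman \<phi> xstar (v 0)"
      using lyap[of t] nonneg[of xstar "v t"] by (simp add: B algebra_simps)
    finally have "?gap \<le> 1 / spag_Abar \<sigma> \<gamma> t * bregman \<phi> xstar (v 0)"
      using Abar_pos by (simp add: field_simps)
    with False show ?thesis by (simp add: Phi_dom x xs)
  qed simp
qed

end
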